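(* Let $0<\alpha\le 1$, $\tau_1,\tau_2\ge 0$, $\gamma\in\mathbb{R}$, put $r=\tau_1+\tau_2$, and let $\phi\in C([-r,0],\mathbb{R})$. Consider the initial value problem $$D^\alpha x(t)=-\gamma x(t)+g\bigl(x(t-\tau_1)\bigr)-e^{-\gamma\tau_2}\,g\bigl(x(t-\tau_1-\tau_2)\bigr)\quad (t>0),\qquad x(t)=\phi(t)\quad(-r\le t\le 0).$$ If $g:\mathbb{R}\to\mathbb{R}$ is locally Lipschitz continuous, then this problem has a unique solution on a maximal interval $[-r,T_{\max})$. If $g$ is globally Lipschitz continuous, then $T_{\max}=\infty$.
   Context: $D^\alpha$ is the Caputo fractional derivative of order $\alpha$ with base point $0$ (the ordinary derivative when $\alpha=1$). A solution on $[-r,T)$ is a continuous function $x:[-r,T)\to\mathbb{R}$ with $x=\phi$ on $[-r,0]$ that satisfies the equation for $0<t<T$, understood in the equivalent Volterra form $$x(t)=\phi(0)+\frac{1}{\Gamma(\alpha)}\int_0^t(t-s)^{\alpha-1}\Bigl[-\gamma x(s)+g\bigl(x(s-\tau_1)\bigr)-e^{-\gamma\tau_2}g\bigl(x(s-r)\bigr)\Bigr]ds,\qquad 0\le t<T.$$ *)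

theory Defs
  imports "HOL-Analysis.Analysis"
begin

definition sol_interval :: "real \<Rightarrow> ereal \<Rightarrow> real set" where
  "sol_interval r T = {t. - r \<le> t \<and> ereal t < T}"

definition delay_rhs ::
  "real \<Rightarrow> real \<Rightarrow> real \<Rightarrow> (real \<Rightarrow> real) \<Rightarrow> (real \<Rightarrow> real) \<Rightarrow> real \<Rightarrow> real" where
  "delay_rhs \<tau>1 \<tau>2 \<gamma> g x t =
     - \<gamma> * x t + g (x (t - \<tau>1)) - exp (- \<gamma> * \<tau>2) * g (x (t - \<tau>1 - \<tau>2))"

text \<open>
  The Caputo equation of order \<open>\<alpha>\<close> with base point 0 is understood in its Volterra form.
  Functions are total, so only the values of \<open>x\<close> on \<open>[-r, T)\<close> are constrained, where
  \<open>r = \<tau>1 + \<tau>2\<close> and \<open>T = \<infinity>\<close> is allowed. At \<open>s = t\<close> the kernel takes the value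
  \<open>0 powr (\<alpha> - 1) = 0\<close>, also for \<open>\<alpha> = 1\<close>; a single point does not affect the integral.
\<close>

definition is_solution ::
  "real \<Rightarrow> real \<Rightarrow> real \<Rightarrow> real \<Rightarrow> (real \<Rightarrow> real) \<Rightarrow> (real \<Rightarrow> real) \<Rightarrow> ereal \<Rightarrow> (real \<Rightarrow> real) \<Rightarrow> bool"
  where
  "is_solution \<alpha> \<tau>1 \<tau>2 \<gamma> g \<phi> T x \<longleftrightarrow>
     0 < T \<and>
     continuous_on (sol_interval (\<tau>1 + \<tau>2) T) x \<and>
     (\<forall>t\<in>{- (\<tau>1 + \<tau>2)..0}. x t = \<phi> t) \<and>
     (\<forall>t. 0 \<le> t \<and> ereal t < T \<longrightarrow>
        (\<lambda>s. (t - s) powr (\<alpha> - 1) * delay_rhs \<tau>1 \<tau>2 \<gamma> g x s) integrable_on {0..t} \<and>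
        x t = \<phi> 0 + 1 / Gamma \<alpha> *
          integral {0..t} (\<lambda>s. (t - s) powr (\<alpha> - 1) * delay_rhs \<tau>1 \<tau>2 \<gamma> g x s))"

text \<open>
  The library's notion is for time-dependent families; \<open>g\<close> is a constant family here, so the
  time set is immaterial.
\<close>

definition locally_lipschitz :: "(real \<Rightarrow> real) \<Rightarrow> bool" where
  "locally_lipschitz g \<longleftrightarrow> local_lipschitz (UNIV :: real set) UNIV (\<lambda>_. g)"

definition globally_lipschitz :: "(real \<Rightarrow> real) \<Rightarrow> bool" where
  "globally_lipschitz g \<longleftrightarrow> (\<exists>L. L-lipschitz_on UNIV g)"

end

theory Submission
  imports Defs
begin

text \<open>
  Write the equation as \<open>x = \<phi>(0) + J N(x)\<close> on \<open>t \<ge> 0\<close>, with \<open>J\<close> the fractional integral of order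
  \<open>\<alpha>\<close> and \<open>N(x)\<close> the delayed right-hand side. Everything rests on one inequality: measured in the
  weight \<open>exp(l t)\<close>, the operator \<open>J\<close> has norm at most \<open>l powr (- \<alpha>)\<close>
  (\<open>riemann_liouville_exp_bound\<close>), which tends to 0 as \<open>l\<close> grows. The delays cost nothing in this
  weight, because a value from the past is compared with a smaller weight, and two solutions share
  the history \<open>\<phi>\<close>. Hence, wherever \<open>g\<close> is Lipschitz on the values taken, \<open>x \<mapsto> J N(x)\<close> is a
  contraction once \<open>l\<close> is large (\<open>volterra_diff_le\<close>).

  Three consequences give the theorem. On a compact time interval two solutions stay in a compact
  set of values, where \<open>g\<close> is Lipschitz, so their weighted distance is at most a quarter of
  itself, hence 0 (\<open>solution_unique\<close>). If \<open>g\<close> is globally Lipschitz, the Banach fixed point theorem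
  on the whole half-line gives a solution for all time (\<open>global_solution_exists\<close>). If \<open>g\<close> is only
  locally Lipschitz, the argument of \<open>g\<close> is truncated at a level above \<open>\<phi>\<close>; the global solution of
  the truncated equation solves the original one until it reaches that level
  (\<open>local_solution_exists\<close>).

  By uniqueness all solutions agree wherever they are both defined, so their union is again a
  solution, and it is the maximal one (\<open>maximal_solution_exists\<close>). For globally Lipschitz \<open>g\<close> it
  extends the solution with \<open>T = \<infinity>\<close>, so its interval is unbounded.
\<close>

section \<open>The fractional integral\<close>

definition riemann_liouville :: "real \<Rightarrow> (real \<Rightarrow> real) \<Rightarrow> real \<Rightarrow> real" where
  "riemann_liouville \<alpha> h t =
     1 / Gamma \<alpha> * integral {0..t} (\<lambda>s. (t - s) powr (\<alpha> - 1) * h s)"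

text \<open>
  The substitution \<open>w = ((t - s) / t) powr \<alpha>\<close> absorbs the singular kernel into the measure. The
  transformed integrand is continuous on a fixed interval and jointly continuous in \<open>w\<close> and \<open>t\<close>;
  integrability and continuity in \<open>t\<close> thus reduce to facts on continuous integrands.
\<close>

lemma has_integral_abel_substitution:
  fixes h :: "real \<Rightarrow> real"
  assumes "0 < \<alpha>" and "0 \<le> t" and h: "continuous_on {0..t} h"
  shows "((\<lambda>s. (t - s) powr (\<alpha> - 1) * h s) has_integral
           t powr \<alpha> / \<alpha> * integral {0..1} (\<lambda>w. h (t - t * w powr (1 / \<alpha>)))) {0..t}"
proof (cases "t = 0")
  case True
  then show ?thesis using has_integral_refl(2)[of _ 0] by simp
next
  case False
  then have t: "0 < t" using \<open>0 \<le> t\<close> by simp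
  let ?f = "\<lambda>w. h (t - t * w powr (1 / \<alpha>))"
  let ?g = "\<lambda>s. ((t - s) / t) powr \<alpha>"
  let ?g' = "\<lambda>s. - (\<alpha> * ((t - s) / t) powr (\<alpha> - 1) / t)"
  \<comment> \<open>\<open>?g\<close> decreases from 1 to 0, so the orientation of the integral flips; the endpoint \<open>t\<close> is
    exceptional because \<open>?g\<close> need not be differentiable there.\<close>
  have "((\<lambda>s. ?g' s *\<^sub>R ?f (?g s)) has_integral
          (integral {?g 0..?g t} ?f - integral {?g t..?g 0} ?f)) {0..t}"
  proof (rule has_integral_substitution_general[where s = "{t}" and c = 0 and d = 1])
    show "?g ` {0..t} \<subseteq> {0..1}"
      using t \<open>0 < \<alpha>\<close> by (auto intro!: powr_le1)
    have "w powr (1 / \<alpha>) \<le> 1" if "0 \<le> w" "w \<le> 1" for w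
      using that \<open>0 < \<alpha>\<close> by (intro powr_le1) auto
    then show "continuous_on {0..1} ?f"
      using t \<open>0 < \<alpha>\<close>
      by (intro continuous_on_compose2[OF h] continuous_intros continuous_on_powr')
         (auto simp: mult_left_le)
    show "continuous_on {0..t} ?g"
      using t \<open>0 < \<alpha>\<close> by (intro continuous_on_powr' continuous_intros) auto
    show "(?g has_field_derivative ?g' s) (at s within {0..t})" if "s \<in> {0..t} - {t}" for s
      using that t
      by (auto intro!: derivative_eq_intros simp: powr_diff field_simps)
  qed (use t in auto)
  then have "((\<lambda>s. ?g' s * ?f (?g s)) has_integral - integral {0..1} ?f) {0..t}"
    using t by simp
  from has_integral_mult_right[OF this, of "- (t powr \<alpha> / \<alpha>)"]
  have "((\<lambda>s. - (t powr \<alpha> / \<alpha>) * (?g' s * ?f (?g s))) has_integral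
          t powr \<alpha> / \<alpha> * integral {0..1} ?f) {0..t}" by simp
  moreover have "- (t powr \<alpha> / \<alpha>) * (?g' s * ?f (?g s)) = (t - s) powr (\<alpha> - 1) * h s"
    if "s \<in> {0..t}" for s
  proof -
    have "?g s powr (1 / \<alpha>) = (t - s) / t"
      using that t \<open>0 < \<alpha>\<close> by (simp add: powr_powr)
    then have "?f (?g s) = h s" using t by simp
    moreover have "t powr \<alpha> / \<alpha> * (\<alpha> * ((t - s) / t) powr (\<alpha> - 1) / t) = (t - s) powr (\<alpha> - 1)"
      using that t \<open>0 < \<alpha>\<close> by (simp add: powr_divide powr_diff)
    moreover have "- (a::real) * (- b * c) = a * b * c" for a b c by simp
    ultimately show ?thesis by metis
  qed
  ultimately show ?thesis
    by (rule has_integral_eq[rotated])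
qed

lemma continuous_on_riemann_liouville:
  assumes "0 < \<alpha>" and h: "continuous_on {0..} h"
  shows "continuous_on {0..} (riemann_liouville \<alpha> h)"
proof -
  have le1: "w powr (1 / \<alpha>) \<le> 1" if "0 \<le> w" "w \<le> 1" for w :: real
    using that \<open>0 < \<alpha>\<close> by (intro powr_le1) auto
  have "continuous_on ({0..} \<times> cbox 0 1) (\<lambda>(t, w). h (t - t * w powr (1 / \<alpha>)))"
    unfolding case_prod_beta
    using \<open>0 < \<alpha>\<close> le1
    by (intro continuous_on_compose2[OF h] continuous_intros continuous_on_powr')
       (auto simp: mult_left_le)
  then have "continuous_on {0..} (\<lambda>t. integral {0..1} (\<lambda>w. h (t - t * w powr (1 / \<alpha>))))"
    using integral_continuous_on_param by fastforce
  then have "continuous_on {0..} (\<lambda>t. 1 / Gamma \<alpha> * (t powr \<alpha> / \<alpha> *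
      integral {0..1} (\<lambda>w. h (t - t * w powr (1 / \<alpha>)))))"
    using \<open>0 < \<alpha>\<close> by (intro continuous_intros continuous_on_powr') auto
  moreover have "riemann_liouville \<alpha> h t = 1 / Gamma \<alpha> * (t powr \<alpha> / \<alpha> *
      integral {0..1} (\<lambda>w. h (t - t * w powr (1 / \<alpha>))))" if "t \<in> {0..}" for t
  proof -
    have "continuous_on {0..t} h" using h by (rule continuous_on_subset) auto
    with has_integral_abel_substitution[OF \<open>0 < \<alpha>\<close> _ this] that show ?thesis
      by (auto simp: riemann_liouville_def dest: integral_unique)
  qed
  ultimately show ?thesis by (rule continuous_on_eq[OF _ sym])
qed

text \<open>
  Put \<open>u = l (t - s)\<close>: the left-hand side becomes \<open>l powr (- \<alpha>) * exp (l * t)\<close> times the integral of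
  \<open>u powr (\<alpha> - 1) * exp (- u)\<close> over \<open>[0, l t]\<close>, an incomplete Gamma integral.
\<close>

lemma abel_integral_exp_le:
  fixes \<alpha> l t :: real
  assumes "0 < \<alpha>" and "0 < l" and "0 \<le> t"
  shows "integral {0..t} (\<lambda>s. (t - s) powr (\<alpha> - 1) * exp (l * s))
           \<le> Gamma \<alpha> * l powr (- \<alpha>) * exp (l * t)"
proof -
  define f where "f u = u powr (\<alpha> - 1) / exp u" for u :: real
  have Gam: "(f has_integral Gamma \<alpha>) {0..}"
    unfolding f_def using \<open>0 < \<alpha>\<close> by (rule Gamma_integral_real)
  have int: "f integrable_on cbox 0 (l * t)"
    using has_integral_integrable[OF Gam] by (rule integrable_on_subcbox) auto
  have "integral {0..l * t} f \<le> integral {0..} f"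
  proof (rule integral_subset_le)
    show "f integrable_on {0..l * t}" using int by simp
    show "f integrable_on {0..}" using Gam by (rule has_integral_integrable)
  qed (auto simp: f_def)
  then have le: "integral {0..l * t} f \<le> Gamma \<alpha>"
    by (simp only: integral_unique[OF Gam])
  have "((\<lambda>s. f ((- l) *\<^sub>R s + l * t)) has_integral
           (1 / \<bar>- l\<bar> ^ DIM(real)) *\<^sub>R integral (cbox 0 (l * t)) f)
         ((\<lambda>x. (1 / (- l)) *\<^sub>R x + - ((1 / (- l)) *\<^sub>R (l * t))) ` cbox 0 (l * t))"
    by (rule has_integral_affinity[OF integrable_integral[OF int]]) (use \<open>0 < l\<close> in simp)
  also have "(\<lambda>x. (1 / (- l)) *\<^sub>R x + - ((1 / (- l)) *\<^sub>R (l * t))) ` cbox 0 (l * t) = {0..t}"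
    using \<open>0 < l\<close> \<open>0 \<le> t\<close> image_affinity_atLeastAtMost[of "- 1 / l" t 0 "l * t"] by simp
  finally have "((\<lambda>s. f (l * t - l * s)) has_integral 1 / l * integral {0..l * t} f) {0..t}"
    using \<open>0 < l\<close> by (simp add: add.commute)
  from has_integral_mult_right[OF this, of "l powr (1 - \<alpha>) * exp (l * t)"]
  have *: "((\<lambda>s. l powr (1 - \<alpha>) * exp (l * t) * f (l * t - l * s)) has_integral
          l powr (1 - \<alpha>) * exp (l * t) * (1 / l * integral {0..l * t} f)) {0..t}" .
  have eq: "l powr (1 - \<alpha>) * exp (l * t) * f (l * t - l * s) = (t - s) powr (\<alpha> - 1) * exp (l * s)"
    if "s \<in> {0..t}" for s
  proof -
    have "l powr (1 - \<alpha>) * exp (l * t) * f (l * t - l * s)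
        = l powr (1 - \<alpha>) * (l * t - l * s) powr (\<alpha> - 1) * (exp (l * t) / exp (l * t - l * s))"
      by (simp add: f_def)
    also have "(l * t - l * s) powr (\<alpha> - 1) = l powr (\<alpha> - 1) * (t - s) powr (\<alpha> - 1)"
      by (metis powr_mult right_diff_distrib)
    also have "exp (l * t) / exp (l * t - l * s) = exp (l * s)"
      using exp_diff[of "l * t" "l * t - l * s"] by simp
    also have "l powr (1 - \<alpha>) * (l powr (\<alpha> - 1) * (t - s) powr (\<alpha> - 1)) = (t - s) powr (\<alpha> - 1)"
      using powr_add[of l "1 - \<alpha>" "\<alpha> - 1"] \<open>0 < l\<close> by (simp flip: mult.assoc)
    finally show ?thesis .
  qed
  have "integral {0..t} (\<lambda>s. (t - s) powr (\<alpha> - 1) * exp (l * s))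
      = l powr (1 - \<alpha>) * exp (l * t) * (1 / l * integral {0..l * t} f)"
    using has_integral_eq[OF eq *] by (rule integral_unique)
  also have "\<dots> \<le> l powr (1 - \<alpha>) * exp (l * t) * (1 / l * Gamma \<alpha>)"
    using \<open>0 < l\<close> le by (intro mult_left_mono) auto
  also have "\<dots> = Gamma \<alpha> * l powr (- \<alpha>) * exp (l * t)"
    using powr_diff[of l "- \<alpha>" "- 1"] powr_add[of l "- \<alpha>" 1] \<open>0 < l\<close>
    by (simp add: add.commute)
  finally show ?thesis .
qed

text \<open>
  In the norm weighted by \<open>exp (l * t)\<close> the fractional integral has norm at most \<open>l powr (- \<alpha>)\<close>. The
  Gamma factor of the kernel estimate cancels against the normalisation of the integral.
\<close>

lemma riemann_liouville_exp_bound: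
  assumes "0 < \<alpha>" and "0 < l" and "0 \<le> t" and h: "continuous_on {0..t} h"
    and bound: "\<And>s. s \<in> {0..t} \<Longrightarrow> \<bar>h s\<bar> \<le> K * exp (l * s)"
  shows "\<bar>riemann_liouville \<alpha> h t\<bar> \<le> K * l powr (- \<alpha>) * exp (l * t)"
proof -
  have "0 \<le> K"
    using bound[of 0] \<open>0 \<le> t\<close> abs_ge_zero[of "h 0"] by simp
  have int: "(\<lambda>s. (t - s) powr (\<alpha> - 1) * k s) integrable_on {0..t}"
    if "continuous_on {0..t} k" for k
    using has_integral_abel_substitution[OF \<open>0 < \<alpha>\<close> \<open>0 \<le> t\<close> that] by blast
  have "\<bar>integral {0..t} (\<lambda>s. (t - s) powr (\<alpha> - 1) * h s)\<bar>
      \<le> integral {0..t} (\<lambda>s. (t - s) powr (\<alpha> - 1) * (K * exp (l * s)))"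
    unfolding real_norm_def[symmetric]
  proof (rule integral_norm_bound_integral)
    show "(\<lambda>s. (t - s) powr (\<alpha> - 1) * h s) integrable_on {0..t}" using h by (rule int)
    show "(\<lambda>s. (t - s) powr (\<alpha> - 1) * (K * exp (l * s))) integrable_on {0..t}"
      by (rule int) (intro continuous_intros)
    show "norm ((t - s) powr (\<alpha> - 1) * h s) \<le> (t - s) powr (\<alpha> - 1) * (K * exp (l * s))"
      if "s \<in> {0..t}" for s
      using mult_left_mono[OF bound[OF that], of "(t - s) powr (\<alpha> - 1)"] by (simp add: abs_mult)
  qed
  also have "\<dots> = K * integral {0..t} (\<lambda>s. (t - s) powr (\<alpha> - 1) * exp (l * s))"
    unfolding mult.left_commute[of _ K] by (rule integral_mult_right)
  also have "\<dots> \<le> K * (Gamma \<alpha> * l powr (- \<alpha>) * exp (l * t))"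
    using assms \<open>0 \<le> K\<close> by (intro mult_left_mono abel_integral_exp_le)
  finally have le: "\<bar>integral {0..t} (\<lambda>s. (t - s) powr (\<alpha> - 1) * h s)\<bar>
      \<le> K * (Gamma \<alpha> * l powr (- \<alpha>) * exp (l * t))" .
  have \<Gamma>: "0 < Gamma \<alpha>" using \<open>0 < \<alpha>\<close> by (rule Gamma_real_pos)
  have "\<bar>riemann_liouville \<alpha> h t\<bar>
      = \<bar>integral {0..t} (\<lambda>s. (t - s) powr (\<alpha> - 1) * h s)\<bar> / Gamma \<alpha>"
    unfolding riemann_liouville_def abs_mult using \<Gamma> by simp
  also have "\<dots> \<le> K * (Gamma \<alpha> * l powr (- \<alpha>) * exp (l * t)) / Gamma \<alpha>"
    using le \<Gamma> by (intro divide_right_mono) auto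
  also have "\<dots> = K * l powr (- \<alpha>) * exp (l * t)" using \<Gamma> by simp
  finally show ?thesis .
qed

lemma riemann_liouville_diff:
  assumes "0 < \<alpha>" and "0 \<le> t" and "continuous_on {0..t} h" and "continuous_on {0..t} k"
  shows "riemann_liouville \<alpha> h t - riemann_liouville \<alpha> k t
           = riemann_liouville \<alpha> (\<lambda>s. h s - k s) t"
proof -
  have "(\<lambda>s. (t - s) powr (\<alpha> - 1) * f s) integrable_on {0..t}"
    if "continuous_on {0..t} f" for f
    using has_integral_abel_substitution[OF \<open>0 < \<alpha>\<close> \<open>0 \<le> t\<close> that] by blast
  from integral_diff[OF this this, OF assms(3,4)] show ?thesis
    by (simp only: riemann_liouville_def right_diff_distrib)
qed

section \<open>The right-hand side with delays\<close>

lemma continuous_on_delay_rhs: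
  assumes x: "continuous_on S x" and B: "x ` S \<subseteq> B" and g: "continuous_on B g"
    and A: "\<And>s. s \<in> A \<Longrightarrow> {s, s - \<tau>1, s - \<tau>1 - \<tau>2} \<subseteq> S"
  shows "continuous_on A (delay_rhs \<tau>1 \<tau>2 \<gamma> g x)"
proof -
  have x_lag: "continuous_on A (\<lambda>s. x (f s))"
    if "continuous_on A f" and "\<And>s. s \<in> A \<Longrightarrow> f s \<in> S" for f
    using that by (intro continuous_on_compose2[OF x]) auto
  have g_lag: "continuous_on A (\<lambda>s. g (x (f s)))"
    if "continuous_on A f" and "\<And>s. s \<in> A \<Longrightarrow> f s \<in> S" for f
    using x_lag[OF that] that(2) B by (intro continuous_on_compose2[OF g]) auto
  show ?thesis
    unfolding delay_rhs_def
    by (intro continuous_on_add continuous_on_diff continuous_on_mult continuous_on_const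
        x_lag g_lag continuous_on_id) (use A in auto)
qed

lemma delay_rhs_diff_le:
  assumes L: "L-lipschitz_on B g"
    and near: "\<And>u. u \<in> {s, s - \<tau>1, s - \<tau>1 - \<tau>2} \<Longrightarrow> x u \<in> B \<and> y u \<in> B \<and> \<bar>x u - y u\<bar> \<le> m"
  shows "\<bar>delay_rhs \<tau>1 \<tau>2 \<gamma> g x s - delay_rhs \<tau>1 \<tau>2 \<gamma> g y s\<bar>
           \<le> (\<bar>\<gamma>\<bar> + L * (1 + exp (- \<gamma> * \<tau>2))) * m"
proof -
  have g: "\<bar>g (x u) - g (y u)\<bar> \<le> L * m" if "u \<in> {s, s - \<tau>1, s - \<tau>1 - \<tau>2}" for u
  proof -
    have "\<bar>g (x u) - g (y u)\<bar> \<le> L * \<bar>x u - y u\<bar>"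
      using lipschitz_onD[OF L, of "x u" "y u"] near[OF that] by (simp add: dist_real_def)
    also have "\<dots> \<le> L * m"
      using near[OF that] lipschitz_on_nonneg[OF L] by (intro mult_left_mono) auto
    finally show ?thesis .
  qed
  have "delay_rhs \<tau>1 \<tau>2 \<gamma> g x s - delay_rhs \<tau>1 \<tau>2 \<gamma> g y s =
      - (\<gamma> * (x s - y s)) + (g (x (s - \<tau>1)) - g (y (s - \<tau>1)))
      - exp (- \<gamma> * \<tau>2) * (g (x (s - \<tau>1 - \<tau>2)) - g (y (s - \<tau>1 - \<tau>2)))"
    by (simp add: delay_rhs_def algebra_simps)
  then have "\<bar>delay_rhs \<tau>1 \<tau>2 \<gamma> g x s - delay_rhs \<tau>1 \<tau>2 \<gamma> g y s\<bar>
      \<le> \<bar>\<gamma> * (x s - y s)\<bar> + \<bar>g (x (s - \<tau>1)) - g (y (s - \<tau>1))\<bar>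
        + \<bar>exp (- \<gamma> * \<tau>2) * (g (x (s - \<tau>1 - \<tau>2)) - g (y (s - \<tau>1 - \<tau>2)))\<bar>"
    by linarith
  also have "\<dots> \<le> \<bar>\<gamma>\<bar> * m + L * m + exp (- \<gamma> * \<tau>2) * (L * m)"
    unfolding abs_mult abs_exp_cancel
    by (intro add_mono mult_left_mono g) (use near[of s] in auto)
  also have "\<dots> = (\<bar>\<gamma>\<bar> + L * (1 + exp (- \<gamma> * \<tau>2))) * m"
    by (simp only: distrib_left distrib_right mult_1_right mult_ac add_ac)
  finally show ?thesis .
qed

text \<open>
  The weight \<open>exp (l * max 0 u)\<close> is constant on the history and increasing afterwards, so a bound at
  the delayed times \<open>s - \<tau>1\<close> and \<open>s - \<tau>1 - \<tau>2\<close> is also one with the weight at \<open>s\<close>. The set \<open>B\<close> of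
  values is left free: a bounded interval serves for uniqueness, all of \<open>\<real>\<close> for existence.
\<close>

lemma volterra_diff_le:
  assumes "0 < \<alpha>" and "0 < l" and "0 \<le> \<tau>1" and "0 \<le> \<tau>2" and "0 \<le> t"
    and L: "L-lipschitz_on B g"
    and x: "continuous_on {- (\<tau>1 + \<tau>2)..t} x" "x ` {- (\<tau>1 + \<tau>2)..t} \<subseteq> B"
    and y: "continuous_on {- (\<tau>1 + \<tau>2)..t} y" "y ` {- (\<tau>1 + \<tau>2)..t} \<subseteq> B"
    and M: "\<And>u. u \<in> {- (\<tau>1 + \<tau>2)..t} \<Longrightarrow> \<bar>x u - y u\<bar> \<le> M * exp (l * max 0 u)"
  shows "\<bar>riemann_liouville \<alpha> (delay_rhs \<tau>1 \<tau>2 \<gamma> g x) t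
            - riemann_liouville \<alpha> (delay_rhs \<tau>1 \<tau>2 \<gamma> g y) t\<bar>
           \<le> (\<bar>\<gamma>\<bar> + L * (1 + exp (- \<gamma> * \<tau>2))) * l powr (- \<alpha>) * M * exp (l * t)"
proof -
  have past: "{s, s - \<tau>1, s - \<tau>1 - \<tau>2} \<subseteq> {- (\<tau>1 + \<tau>2)..t}" if "s \<in> {0..t}" for s
    using that \<open>0 \<le> \<tau>1\<close> \<open>0 \<le> \<tau>2\<close> by auto
  have cont: "continuous_on {0..t} (delay_rhs \<tau>1 \<tau>2 \<gamma> g x)"
       "continuous_on {0..t} (delay_rhs \<tau>1 \<tau>2 \<gamma> g y)"
    by (rule continuous_on_delay_rhs[OF x lipschitz_on_continuous_on[OF L] past], assumption)
       (rule continuous_on_delay_rhs[OF y lipschitz_on_continuous_on[OF L] past])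
  have "0 \<le> M"
    using order_trans[OF abs_ge_zero M[of 0]] \<open>0 \<le> t\<close> \<open>0 \<le> \<tau>1\<close> \<open>0 \<le> \<tau>2\<close> by simp
  define C where "C = \<bar>\<gamma>\<bar> + L * (1 + exp (- \<gamma> * \<tau>2))"
  have bound: "\<bar>delay_rhs \<tau>1 \<tau>2 \<gamma> g x s - delay_rhs \<tau>1 \<tau>2 \<gamma> g y s\<bar> \<le> C * M * exp (l * s)"
    if s: "s \<in> {0..t}" for s
    unfolding C_def mult.assoc[of _ M]
  proof (rule delay_rhs_diff_le[OF L])
    fix u assume u: "u \<in> {s, s - \<tau>1, s - \<tau>1 - \<tau>2}"
    with past[OF s] have u': "u \<in> {- (\<tau>1 + \<tau>2)..t}" by blast
    have "max 0 u \<le> s" using u s \<open>0 \<le> \<tau>1\<close> \<open>0 \<le> \<tau>2\<close> by auto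
    then have "M * exp (l * max 0 u) \<le> M * exp (l * s)"
      using \<open>0 \<le> M\<close> \<open>0 < l\<close> by (intro mult_left_mono) auto
    with M[OF u'] have "\<bar>x u - y u\<bar> \<le> M * exp (l * s)" by (rule order_trans)
    then show "x u \<in> B \<and> y u \<in> B \<and> \<bar>x u - y u\<bar> \<le> M * exp (l * s)"
      using x(2) y(2) u' by blast
  qed
  have "riemann_liouville \<alpha> (delay_rhs \<tau>1 \<tau>2 \<gamma> g x) t
          - riemann_liouville \<alpha> (delay_rhs \<tau>1 \<tau>2 \<gamma> g y) t
      = riemann_liouville \<alpha> (\<lambda>s. delay_rhs \<tau>1 \<tau>2 \<gamma> g x s - delay_rhs \<tau>1 \<tau>2 \<gamma> g y s) t"
    using \<open>0 < \<alpha>\<close> \<open>0 \<le> t\<close> cont by (rule riemann_liouville_diff)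
  moreover have "\<bar>\<dots>\<bar> \<le> C * M * l powr (- \<alpha>) * exp (l * t)"
    using \<open>0 < \<alpha>\<close> \<open>0 < l\<close> \<open>0 \<le> t\<close> continuous_on_diff[OF cont] bound
    by (rule riemann_liouville_exp_bound)
  moreover have "C * M * l powr (- \<alpha>) = C * l powr (- \<alpha>) * M" by simp
  ultimately show ?thesis by (simp only: C_def)
qed

text \<open>
  The bound 1/4, rather than 1/2, leaves room for the factor 2 that the parametrisation used
  for existence brings in.
\<close>

lemma contraction_weight_exists:
  fixes K \<alpha> :: real
  assumes "0 < \<alpha>" and "0 \<le> K"
  obtains l where "0 < l" and "K * l powr (- \<alpha>) \<le> 1 / 4"
proof -
  let ?l = "(4 * K + 1) powr (1 / \<alpha>)"
  have pos: "0 < ?l" using assms by simp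
  have val: "?l powr (- \<alpha>) = 1 / (4 * K + 1)"
    using assms by (simp add: powr_powr powr_minus divide_simps)
  have "K * (1 / (4 * K + 1)) \<le> 1 / 4"
    using assms by (simp add: divide_simps)
  then have "K * ?l powr (- \<alpha>) \<le> 1 / 4" unfolding val .
  with pos show thesis by (rule that)
qed

section \<open>Solutions\<close>

lemma is_solutionD:
  assumes "is_solution \<alpha> \<tau>1 \<tau>2 \<gamma> g \<phi> T x"
  shows "0 < T" and "continuous_on (sol_interval (\<tau>1 + \<tau>2) T) x"
    and "\<And>t. t \<in> {- (\<tau>1 + \<tau>2)..0} \<Longrightarrow> x t = \<phi> t"
    and "\<And>t. 0 \<le> t \<Longrightarrow> ereal t < T \<Longrightarrow>
           x t = \<phi> 0 + riemann_liouville \<alpha> (delay_rhs \<tau>1 \<tau>2 \<gamma> g x) t"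
  using assms unfolding is_solution_def riemann_liouville_def by blast+

text \<open>
  The integrability condition follows by substitution, because \<open>delay_rhs\<close> is continuous in time
  along a continuous \<open>x\<close>.
\<close>

lemma is_solutionI:
  assumes "0 < \<alpha>" and "0 \<le> \<tau>1" and "0 \<le> \<tau>2" and g: "continuous_on UNIV g"
    and "0 < T" and x: "continuous_on (sol_interval (\<tau>1 + \<tau>2) T) x"
    and "\<And>t. t \<in> {- (\<tau>1 + \<tau>2)..0} \<Longrightarrow> x t = \<phi> t"
    and "\<And>t. 0 \<le> t \<Longrightarrow> ereal t < T \<Longrightarrow>
           x t = \<phi> 0 + riemann_liouville \<alpha> (delay_rhs \<tau>1 \<tau>2 \<gamma> g x) t"
  shows "is_solution \<alpha> \<tau>1 \<tau>2 \<gamma> g \<phi> T x"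
proof -
  have "(\<lambda>s. (t - s) powr (\<alpha> - 1) * delay_rhs \<tau>1 \<tau>2 \<gamma> g x s) integrable_on {0..t}"
    if "0 \<le> t" "ereal t < T" for t
  proof -
    have "ereal s < T" if "s \<le> t" for s
      using that \<open>ereal t < T\<close> by (meson ereal_less_eq(3) le_less_trans)
    then have "continuous_on {0..t} (delay_rhs \<tau>1 \<tau>2 \<gamma> g x)"
      using assms(2,3)
      by (intro continuous_on_delay_rhs[OF x _ g]) (auto simp: sol_interval_def)
    then show ?thesis
      using has_integral_abel_substitution[OF \<open>0 < \<alpha>\<close> \<open>0 \<le> t\<close>] by blast
  qed
  then show ?thesis
    unfolding is_solution_def riemann_liouville_def[symmetric]
    using assms(5-8) by (intro conjI ballI allI impI) blast+
qed

section \<open>Uniqueness\<close>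

lemma locally_lipschitz_on_interval:
  assumes "locally_lipschitz g"
  obtains L where "L-lipschitz_on {- R..R} g"
proof -
  have "local_lipschitz {0 :: real} {- R..R} (\<lambda>_. g)"
    using assms unfolding locally_lipschitz_def by (rule local_lipschitz_subset) auto
  then obtain L where "\<And>t. t \<in> {0 :: real} \<Longrightarrow> L-lipschitz_on {- R..R} g"
    by (rule local_lipschitz_compact_implies_lipschitz) auto
  then show thesis using that by simp
qed

lemma locally_lipschitz_continuous_on:
  assumes "locally_lipschitz g"
  shows "continuous_on UNIV g"
  using local_lipschitz_continuous_on[of UNIV UNIV "\<lambda>_ :: real. g"] assms
  by (simp add: locally_lipschitz_def)

text \<open>
  Up to time \<open>t\<close> both solutions take values in one interval \<open>[-R, R]\<close>, on which \<open>g\<close> is Lipschitz.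
  Their weighted distance attains its maximum on \<open>[0, t]\<close> at some \<open>u\<close>; the contraction estimate
  at \<open>u\<close> bounds this maximum by a quarter of itself.
\<close>

lemma solution_unique:
  assumes "0 < \<alpha>" and "0 \<le> \<tau>1" and "0 \<le> \<tau>2" and g: "locally_lipschitz g"
    and x: "is_solution \<alpha> \<tau>1 \<tau>2 \<gamma> g \<phi> T x" and y: "is_solution \<alpha> \<tau>1 \<tau>2 \<gamma> g \<phi> T' y"
    and t: "t \<in> sol_interval (\<tau>1 + \<tau>2) T" "t \<in> sol_interval (\<tau>1 + \<tau>2) T'"
  shows "x t = y t"
proof (cases "t \<le> 0")
  case True
  with t show ?thesis
    using is_solutionD(3)[OF x, of t] is_solutionD(3)[OF y, of t] by (simp add: sol_interval_def)
next
  case False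
  then have "0 \<le> t" by simp
  let ?I = "{- (\<tau>1 + \<tau>2)..t}"
  have dom: "ereal s < T" "ereal s < T'" if "s \<le> t" for s
    using that t by (auto simp: sol_interval_def intro: le_less_trans[of _ "ereal t"])
  have cont: "continuous_on ?I x" "continuous_on ?I y"
    using dom
    by (auto intro!: continuous_on_subset[OF is_solutionD(2)[OF x]]
        continuous_on_subset[OF is_solutionD(2)[OF y]] simp: sol_interval_def)
  then have "bounded (x ` ?I \<union> y ` ?I)"
    by (intro bounded_Un[THEN iffD2] conjI compact_imp_bounded compact_continuous_image) auto
  then obtain R where "\<forall>v \<in> x ` ?I \<union> y ` ?I. \<bar>v\<bar> \<le> R"
    unfolding bounded_iff real_norm_def by blast
  then have R: "x ` ?I \<subseteq> {- R..R}" "y ` ?I \<subseteq> {- R..R}"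
    by (auto simp: abs_le_iff minus_le_iff)
  obtain L where L: "L-lipschitz_on {- R..R} g"
    using g by (rule locally_lipschitz_on_interval)
  define K where "K = \<bar>\<gamma>\<bar> + L * (1 + exp (- \<gamma> * \<tau>2))"
  have "0 \<le> K" using lipschitz_on_nonneg[OF L] by (simp add: K_def)
  with \<open>0 < \<alpha>\<close> obtain l where l: "0 < l" "K * l powr (- \<alpha>) \<le> 1 / 4"
    by (rule contraction_weight_exists)
  let ?d = "\<lambda>u. \<bar>x u - y u\<bar> / exp (l * u)"
  have "continuous_on {0..t} ?d"
    using \<open>0 \<le> \<tau>1\<close> \<open>0 \<le> \<tau>2\<close>
    by (intro continuous_intros continuous_on_subset[OF cont(1)] continuous_on_subset[OF cont(2)])
       auto
  then obtain u where u: "u \<in> {0..t}" and max: "\<And>s. s \<in> {0..t} \<Longrightarrow> ?d s \<le> ?d u"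
    using continuous_attains_sup[of "{0..t}" ?d] \<open>0 \<le> t\<close> by auto
  have sub: "{- (\<tau>1 + \<tau>2)..u} \<subseteq> ?I" using u by auto
  have "\<bar>riemann_liouville \<alpha> (delay_rhs \<tau>1 \<tau>2 \<gamma> g x) u
          - riemann_liouville \<alpha> (delay_rhs \<tau>1 \<tau>2 \<gamma> g y) u\<bar>
      \<le> (\<bar>\<gamma>\<bar> + L * (1 + exp (- \<gamma> * \<tau>2))) * l powr (- \<alpha>) * ?d u * exp (l * u)"
  proof (rule volterra_diff_le[OF \<open>0 < \<alpha>\<close> \<open>0 < l\<close> \<open>0 \<le> \<tau>1\<close> \<open>0 \<le> \<tau>2\<close> _ L])
    show "\<bar>x s - y s\<bar> \<le> ?d u * exp (l * max 0 s)" if s: "s \<in> {- (\<tau>1 + \<tau>2)..u}" for s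
    proof (cases "s \<le> 0")
      case True
      with s show ?thesis
        using is_solutionD(3)[OF x, of s] is_solutionD(3)[OF y, of s] by simp
    next
      case False
      with s u max[of s] show ?thesis by (simp add: pos_divide_le_eq)
    qed
    show "0 \<le> u" using u by simp
  qed (use sub cont R in \<open>blast intro: continuous_on_subset\<close>)+
  moreover have "x u - y u = riemann_liouville \<alpha> (delay_rhs \<tau>1 \<tau>2 \<gamma> g x) u
          - riemann_liouville \<alpha> (delay_rhs \<tau>1 \<tau>2 \<gamma> g y) u"
    using is_solutionD(4)[OF x, of u] is_solutionD(4)[OF y, of u] u dom[of u] by simp
  ultimately have "\<bar>x u - y u\<bar> \<le> (K * l powr (- \<alpha>)) * \<bar>x u - y u\<bar>"
    by (simp add: K_def)
  also have "\<dots> \<le> 1 / 4 * \<bar>x u - y u\<bar>"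
    using l by (intro mult_right_mono) auto
  finally have "?d u = 0" by simp
  then show ?thesis
    using max[of t] \<open>0 \<le> t\<close> by (simp add: divide_le_0_iff)
qed

section \<open>Existence\<close>

text \<open>
  Solutions are sought as \<open>x(t) = \<phi>(0) + exp (l * t) * z(t)\<close> with \<open>z\<close> bounded and continuous, so
  that the supremum norm of \<open>z\<close> is the weighted norm of \<open>x\<close> and the Banach fixed point theorem applies
  on all of \<open>[0, \<infinity>)\<close> at once.
\<close>

lemma global_solution_exists:
  assumes "0 < \<alpha>" and "0 \<le> \<tau>1" and "0 \<le> \<tau>2"
    and \<phi>: "continuous_on {- (\<tau>1 + \<tau>2)..0} \<phi>" and "globally_lipschitz g"
  obtains x where "is_solution \<alpha> \<tau>1 \<tau>2 \<gamma> g \<phi> \<infinity> x"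
proof -
  obtain L where L: "L-lipschitz_on UNIV g"
    using \<open>globally_lipschitz g\<close> by (auto simp: globally_lipschitz_def)
  have g: "continuous_on UNIV g" using L by (rule lipschitz_on_continuous_on)
  define K where "K = \<bar>\<gamma>\<bar> + L * (1 + exp (- \<gamma> * \<tau>2))"
  have "0 \<le> K" using lipschitz_on_nonneg[OF L] by (simp add: K_def)
  with \<open>0 < \<alpha>\<close> obtain l where l: "0 < l" "K * l powr (- \<alpha>) \<le> 1 / 4"
    by (rule contraction_weight_exists)
  \<comment> \<open>\<open>\<psi>\<close> extends \<open>\<phi>\<close> by constants to a bounded continuous function on the real line.\<close>
  define \<psi> where "\<psi> t = \<phi> (max (- (\<tau>1 + \<tau>2)) (min 0 t))" for t
  have \<psi>: "continuous_on UNIV \<psi>"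
    unfolding \<psi>_def using \<open>0 \<le> \<tau>1\<close> \<open>0 \<le> \<tau>2\<close>
    by (intro continuous_on_compose2[OF \<phi>] continuous_intros) auto
  have "bounded (\<phi> ` {- (\<tau>1 + \<tau>2)..0})"
    using \<phi> by (intro compact_imp_bounded compact_continuous_image) auto
  then obtain P where "\<forall>v \<in> \<phi> ` {- (\<tau>1 + \<tau>2)..0}. \<bar>v\<bar> \<le> P"
    unfolding bounded_iff real_norm_def by blast
  then have P: "\<bar>\<psi> t\<bar> \<le> P" for t
    using \<open>0 \<le> \<tau>1\<close> \<open>0 \<le> \<tau>2\<close> by (auto simp: \<psi>_def)
  \<comment> \<open>Subtracting \<open>z 0\<close> makes \<open>X z\<close> equal to \<open>\<phi>\<close> on the history for every \<open>z\<close>, so that the fixed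
    point can be sought in the whole space; the fixed point itself satisfies \<open>z 0 = 0\<close>.\<close>
  define X where "X z t = \<psi> t + exp (l * max 0 t) * (z (max 0 t) - z 0)"
    for z :: "real \<Rightarrow> real" and t
  define F where "F z t = exp (- (l * max 0 t)) *
      riemann_liouville \<alpha> (delay_rhs \<tau>1 \<tau>2 \<gamma> g (X z)) (max 0 t)" for z t
  have X: "continuous_on UNIV (X z)" if "continuous_on UNIV z" for z
    unfolding X_def by (intro continuous_intros \<psi> continuous_on_compose2[OF that]) auto
  have J: "continuous_on A (delay_rhs \<tau>1 \<tau>2 \<gamma> g (X z))" if "continuous_on UNIV z" for z A
    by (rule continuous_on_delay_rhs[OF X[OF that] _ g]) auto
  have FC: "F z \<in> bcontfun" if z: "z \<in> bcontfun" for z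
  proof -
    have cz: "continuous_on UNIV z" using z by (simp add: bcontfun_def)
    obtain N where N: "\<And>t. \<bar>z t\<bar> \<le> N"
      using z by (auto simp: bcontfun_def bounded_iff)
    have "continuous_on UNIV (F z)"
      unfolding F_def
      by (intro continuous_intros
          continuous_on_compose2[OF continuous_on_riemann_liouville[OF \<open>0 < \<alpha>\<close> J[OF cz]]]) auto
    \<comment> \<open>Boundedness comes from comparing \<open>X z\<close> with the zero function, on which the right-hand side
      is constant.\<close>
    define c where "c = \<bar>g 0 - exp (- \<gamma> * \<tau>2) * g 0\<bar>"
    have "0 \<le> P" using order_trans[OF abs_ge_zero P] .
    have XN: "\<bar>X z u\<bar> \<le> (P + 2 * N) * exp (l * max 0 u)" for u
    proof -
      have "\<bar>z (max 0 u) - z 0\<bar> \<le> 2 * N"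
        using N[of "max 0 u"] N[of 0] by linarith
      then have "\<bar>exp (l * max 0 u) * (z (max 0 u) - z 0)\<bar> \<le> exp (l * max 0 u) * (2 * N)"
        unfolding abs_mult abs_exp_cancel by (intro mult_left_mono) auto
      moreover have "P * 1 \<le> P * exp (l * max 0 u)"
        using \<open>0 \<le> P\<close> l by (intro mult_left_mono) auto
      moreover have "(P + 2 * N) * exp (l * max 0 u)
          = P * exp (l * max 0 u) + exp (l * max 0 u) * (2 * N)"
        by (simp add: algebra_simps)
      ultimately show ?thesis
        using P[of u] unfolding X_def by linarith
    qed
    have "\<bar>delay_rhs \<tau>1 \<tau>2 \<gamma> g (X z) s\<bar> \<le> (K * (P + 2 * N) + c) * exp (l * s)"
      if "0 \<le> s" for s
    proof -
      have "\<bar>delay_rhs \<tau>1 \<tau>2 \<gamma> g (X z) s - delay_rhs \<tau>1 \<tau>2 \<gamma> g (\<lambda>_. 0) s\<bar>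
          \<le> K * ((P + 2 * N) * exp (l * s))"
        unfolding K_def
      proof (rule delay_rhs_diff_le[OF L])
        fix u assume "u \<in> {s, s - \<tau>1, s - \<tau>1 - \<tau>2}"
        then have "max 0 u \<le> s" using that assms(2,3) by auto
        then have "(P + 2 * N) * exp (l * max 0 u) \<le> (P + 2 * N) * exp (l * s)"
          using \<open>0 \<le> P\<close> l order_trans[OF abs_ge_zero N] by (intro mult_left_mono) auto
        with XN[of u] show "X z u \<in> UNIV \<and> (0::real) \<in> UNIV \<and> \<bar>X z u - 0\<bar> \<le> (P + 2 * N) * exp (l * s)"
          by simp
      qed
      moreover have "\<bar>delay_rhs \<tau>1 \<tau>2 \<gamma> g (\<lambda>_. 0) s\<bar> \<le> c * exp (l * s)"
        using that l mult_left_mono[of 1 "exp (l * s)" c]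
        by (simp add: delay_rhs_def c_def)
      ultimately show ?thesis by (simp add: algebra_simps)
    qed
    then have "\<bar>riemann_liouville \<alpha> (delay_rhs \<tau>1 \<tau>2 \<gamma> g (X z)) t\<bar>
        \<le> (K * (P + 2 * N) + c) * l powr (- \<alpha>) * exp (l * t)" if "0 \<le> t" for t
      using that \<open>0 < \<alpha>\<close> l J[OF cz] by (intro riemann_liouville_exp_bound) auto
    from this[of "max 0 t" for t]
    have "norm (F z t) \<le> (K * (P + 2 * N) + c) * l powr (- \<alpha>)" for t
      by (simp add: F_def abs_mult exp_minus field_simps)
    with \<open>continuous_on UNIV (F z)\<close> show ?thesis by (rule bcontfun_normI)
  qed
  define F' where "F' z = Bcontfun (F (apply_bcontfun z))" for z
  have F': "apply_bcontfun (F' z) = F (apply_bcontfun z)" for z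
    unfolding F'_def by (rule Bcontfun_inverse[OF FC[OF apply_bcontfun]])
  have "dist (F' z) (F' w) \<le> 1 / 2 * dist z w" for z w
  proof (rule dist_bound)
    fix t :: real
    let ?t = "max 0 t"
    \<comment> \<open>The factor 2 is the price of the subtracted values at 0.\<close>
    have "\<bar>X z u - X w u\<bar> \<le> (2 * dist z w) * exp (l * max 0 u)" for u
    proof -
      have "\<bar>(z (max 0 u) - z 0) - (w (max 0 u) - w 0)\<bar> \<le> 2 * dist z w"
        using dist_bounded[of z "max 0 u" w] dist_bounded[of z 0 w]
        by (simp add: dist_real_def)
      moreover have "X z u - X w u
          = exp (l * max 0 u) * ((z (max 0 u) - z 0) - (w (max 0 u) - w 0))"
        by (simp add: X_def algebra_simps)
      ultimately show ?thesis by (simp add: abs_mult)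
    qed
    then have "\<bar>riemann_liouville \<alpha> (delay_rhs \<tau>1 \<tau>2 \<gamma> g (X z)) ?t
            - riemann_liouville \<alpha> (delay_rhs \<tau>1 \<tau>2 \<gamma> g (X w)) ?t\<bar>
        \<le> K * l powr (- \<alpha>) * (2 * dist z w) * exp (l * ?t)"
      unfolding K_def using assms(1-3) l
      by (intro volterra_diff_le[where B = UNIV] L continuous_on_subset[OF X]) auto
    also have "\<dots> \<le> 1 / 4 * (2 * dist z w) * exp (l * ?t)"
      using l by (intro mult_right_mono) auto
    finally have "\<bar>riemann_liouville \<alpha> (delay_rhs \<tau>1 \<tau>2 \<gamma> g (X z)) ?t
            - riemann_liouville \<alpha> (delay_rhs \<tau>1 \<tau>2 \<gamma> g (X w)) ?t\<bar>
        \<le> 1 / 2 * dist z w * exp (l * ?t)" by simp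
    then show "dist (F' z t) (F' w t) \<le> 1 / 2 * dist z w"
      by (simp add: F' F_def dist_real_def abs_mult exp_minus field_simps flip: right_diff_distrib)
  qed
  then obtain z where z: "F' z = z"
    using banach_fix_type[of "1 / 2" F'] by auto
  then have fix_z: "z t = F z t" for t using F'[of z] by simp
  have "z 0 = 0" by (subst fix_z) (simp add: F_def riemann_liouville_def)
  have "is_solution \<alpha> \<tau>1 \<tau>2 \<gamma> g \<phi> \<infinity> (X z)"
  proof (rule is_solutionI[OF assms(1-3) g])
    show "continuous_on (sol_interval (\<tau>1 + \<tau>2) \<infinity>) (X z)"
      by (rule continuous_on_subset[OF X]) auto
    show "X z t = \<phi> t" if "t \<in> {- (\<tau>1 + \<tau>2)..0}" for t
      using that by (simp add: X_def \<psi>_def)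
    show "X z t = \<phi> 0 + riemann_liouville \<alpha> (delay_rhs \<tau>1 \<tau>2 \<gamma> g (X z)) t"
      if "0 \<le> t" for t
    proof -
      have "X z t = \<psi> t + exp (l * t) * z t"
        using that \<open>z 0 = 0\<close> by (simp add: X_def)
      also have "exp (l * t) * z t = riemann_liouville \<alpha> (delay_rhs \<tau>1 \<tau>2 \<gamma> g (X z)) t"
        using that by (subst fix_z) (simp add: F_def exp_minus)
      also have "\<psi> t = \<phi> 0" using that assms(2,3) by (simp add: \<psi>_def)
      finally show ?thesis .
    qed
  qed simp
  then show thesis by (rule that)
qed

text \<open>
  Precomposing \<open>g\<close> with the projection onto \<open>[-R, R]\<close> makes it globally Lipschitz. If \<open>R\<close> exceeds
  \<open>\<bar>\<phi>\<bar>\<close>, the global solution of the modified equation remains below \<open>R\<close> in absolute value for a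
  positive time, by continuity, and until then the modification is not felt.
\<close>

lemma local_solution_exists:
  assumes "0 < \<alpha>" and "0 \<le> \<tau>1" and "0 \<le> \<tau>2"
    and \<phi>: "continuous_on {- (\<tau>1 + \<tau>2)..0} \<phi>" and g: "locally_lipschitz g"
  obtains T x where "is_solution \<alpha> \<tau>1 \<tau>2 \<gamma> g \<phi> T x"
proof -
  have "bounded (\<phi> ` {- (\<tau>1 + \<tau>2)..0})"
    using \<phi> by (intro compact_imp_bounded compact_continuous_image) auto
  then obtain R where "0 < R" and R: "\<And>t. t \<in> {- (\<tau>1 + \<tau>2)..0} \<Longrightarrow> \<bar>\<phi> t\<bar> < R"
    unfolding bounded_pos_less by auto
  obtain L where L: "L-lipschitz_on {- R..R} g"
    using g by (rule locally_lipschitz_on_interval)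
  define h where "h v = g (max (- R) (min R v))" for v
  have "L-lipschitz_on UNIV h"
  proof (rule lipschitz_onI)
    fix v w :: real
    have "dist (h v) (h w) \<le> L * dist (max (- R) (min R v)) (max (- R) (min R w))"
      unfolding h_def using \<open>0 < R\<close> by (intro lipschitz_onD[OF L]) auto
    also have "\<dots> \<le> L * dist v w"
      using lipschitz_on_nonneg[OF L] by (intro mult_left_mono) (auto simp: dist_real_def)
    finally show "dist (h v) (h w) \<le> L * dist v w" .
  qed (rule lipschitz_on_nonneg[OF L])
  then have "globally_lipschitz h" by (auto simp: globally_lipschitz_def)
  with assms(1-4) obtain x where x: "is_solution \<alpha> \<tau>1 \<tau>2 \<gamma> h \<phi> \<infinity> x"
    by (rule global_solution_exists)
  have x_cont: "continuous_on {- (\<tau>1 + \<tau>2)..} x"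
    using is_solutionD(2)[OF x] by (simp add: sol_interval_def atLeast_def)
  have "\<bar>x 0\<bar> < R"
    using is_solutionD(3)[OF x, of 0] R[of 0] assms(2,3) by simp
  then obtain d where "0 < d"
    and d: "\<And>t. t \<in> {- (\<tau>1 + \<tau>2)..} \<Longrightarrow> dist t 0 < d \<Longrightarrow> dist (x t) (x 0) < R - \<bar>x 0\<bar>"
    using x_cont assms(2,3) unfolding continuous_on_iff
    by (metis add_nonneg_nonneg atLeast_iff diff_gt_0_iff_gt neg_le_0_iff_le)
  have small: "\<bar>x t\<bar> < R" if "- (\<tau>1 + \<tau>2) \<le> t" "t < d" for t
  proof (cases "t \<le> 0")
    case True
    with that R[of t] is_solutionD(3)[OF x, of t] show ?thesis by simp
  next
    case False
    with that d[of t] show ?thesis by (auto simp: dist_real_def)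
  qed
  have same: "delay_rhs \<tau>1 \<tau>2 \<gamma> h x s = delay_rhs \<tau>1 \<tau>2 \<gamma> g x s" if "0 \<le> s" "s < d" for s
  proof -
    have "h (x u) = g (x u)" if "- (\<tau>1 + \<tau>2) \<le> u" "u < d" for u
    proof -
      have "max (- R) (min R (x u)) = x u" using small[OF that] by linarith
      then show ?thesis by (simp add: h_def)
    qed
    then show ?thesis using that assms(2,3) by (simp add: delay_rhs_def)
  qed
  have "is_solution \<alpha> \<tau>1 \<tau>2 \<gamma> g \<phi> (ereal d) x"
  proof (rule is_solutionI[OF assms(1-3) locally_lipschitz_continuous_on[OF g]])
    show "continuous_on (sol_interval (\<tau>1 + \<tau>2) (ereal d)) x"
      by (rule continuous_on_subset[OF x_cont]) (auto simp: sol_interval_def)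
    show "x t = \<phi> 0 + riemann_liouville \<alpha> (delay_rhs \<tau>1 \<tau>2 \<gamma> g x) t"
      if "0 \<le> t" "ereal t < ereal d" for t
    proof -
      have "riemann_liouville \<alpha> (delay_rhs \<tau>1 \<tau>2 \<gamma> h x) t
          = riemann_liouville \<alpha> (delay_rhs \<tau>1 \<tau>2 \<gamma> g x) t"
        unfolding riemann_liouville_def using that same
        by (intro arg_cong[where f = "\<lambda>v. 1 / Gamma \<alpha> * v"] integral_cong) auto
      with is_solutionD(4)[OF x, of t] that show ?thesis by simp
    qed
  qed (use \<open>0 < d\<close> is_solutionD(3)[OF x] in auto)
  then show thesis by (rule that)
qed

section \<open>The maximal solution\<close>

text \<open>
  The maximal solution is the union of all solutions, well defined by uniqueness. Being a solution
  is a condition on \<open>[-r, t]\<close> for each \<open>t\<close>, plus local continuity, so it passes to the union.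
\<close>

lemma maximal_solution_exists:
  assumes "0 < \<alpha>" and "0 \<le> \<tau>1" and "0 \<le> \<tau>2"
    and \<phi>: "continuous_on {- (\<tau>1 + \<tau>2)..0} \<phi>" and g: "locally_lipschitz g"
  obtains Tmax x where "is_solution \<alpha> \<tau>1 \<tau>2 \<gamma> g \<phi> Tmax x"
    and "\<And>T y. is_solution \<alpha> \<tau>1 \<tau>2 \<gamma> g \<phi> T y \<Longrightarrow> T \<le> Tmax"
    and "\<And>T y t. is_solution \<alpha> \<tau>1 \<tau>2 \<gamma> g \<phi> T y \<Longrightarrow> t \<in> sol_interval (\<tau>1 + \<tau>2) T \<Longrightarrow> y t = x t"
proof -
  let ?sol = "is_solution \<alpha> \<tau>1 \<tau>2 \<gamma> g \<phi>"
  let ?I = "sol_interval (\<tau>1 + \<tau>2)"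
  define Tmax where "Tmax = Sup {T. \<exists>y. ?sol T y}"
  have Tmax: "T \<le> Tmax" if "?sol T y" for T y
    unfolding Tmax_def using that by (intro Sup_upper) auto
  define x where "x t = (SOME v. \<exists>T y. ?sol T y \<and> t \<in> ?I T \<and> v = y t)" for t
  have x_eq: "y t = x t" if "?sol T y" "t \<in> ?I T" for T y t
  proof -
    have "\<exists>T' y'. ?sol T' y' \<and> t \<in> ?I T' \<and> x t = y' t"
      unfolding x_def by (rule someI_ex) (use that in blast)
    then show ?thesis
      using solution_unique[OF assms(1-3) g] that by metis
  qed
  have extend: "\<exists>T y. ?sol T y \<and> t < T" if "t < Tmax" for t
    using that unfolding Tmax_def less_Sup_iff by blast
  have "?sol Tmax x"
  proof (rule is_solutionI[OF assms(1-3) locally_lipschitz_continuous_on[OF g]])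
    obtain T0 y0 where y0: "?sol T0 y0"
      using local_solution_exists[OF assms(1-3) \<phi> g] .
    show "0 < Tmax" using is_solutionD(1)[OF y0] Tmax[OF y0] by simp
    show "x t = \<phi> t" if "t \<in> {- (\<tau>1 + \<tau>2)..0}" for t
    proof -
      have "ereal t < T0"
        using that is_solutionD(1)[OF y0] by (intro le_less_trans[of "ereal t" 0 T0]) auto
      with that is_solutionD(3)[OF y0 that] x_eq[OF y0, of t] show ?thesis
        by (simp add: sol_interval_def)
    qed
    show "x t = \<phi> 0 + riemann_liouville \<alpha> (delay_rhs \<tau>1 \<tau>2 \<gamma> g x) t"
      if "0 \<le> t" and t: "ereal t < Tmax" for t
    proof -
      obtain T y where y: "?sol T y" "ereal t < T" using extend[OF t] by blast
      have xy: "x u = y u" if "- (\<tau>1 + \<tau>2) \<le> u" "u \<le> t" for u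
        using x_eq[OF y(1), of u] that le_less_trans[of "ereal u" "ereal t" T] y(2)
        by (simp add: sol_interval_def)
      have "riemann_liouville \<alpha> (delay_rhs \<tau>1 \<tau>2 \<gamma> g x) t
          = riemann_liouville \<alpha> (delay_rhs \<tau>1 \<tau>2 \<gamma> g y) t"
        unfolding riemann_liouville_def using xy assms(2,3)
        by (intro arg_cong[where f = "\<lambda>v. 1 / Gamma \<alpha> * v"] integral_cong)
           (simp add: delay_rhs_def)
      with is_solutionD(4)[OF y(1) \<open>0 \<le> t\<close> y(2)] xy[of t] \<open>0 \<le> t\<close> assms(2,3) show ?thesis
        by simp
    qed
    show "continuous_on (?I Tmax) x"
      unfolding continuous_on_eq_continuous_within
    proof
      fix t assume t: "t \<in> ?I Tmax"
      then have "ereal t < Tmax" by (simp add: sol_interval_def)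
      from extend[OF this] obtain T y where y: "?sol T y" "ereal t < T" by blast
      then obtain b where b: "t < b" "ereal b < T"
        using ereal_dense2[of "ereal t" T] by auto
      have T: "T \<le> Tmax" using y(1) by (rule Tmax)
      have below: "ereal u < T" if "u < b" for u
        using that b(2) by (meson ereal_less(1) less_ereal.simps(1) less_trans)
      \<comment> \<open>A neighbourhood of \<open>t\<close> in \<open>?I Tmax\<close> already lies in \<open>?I T\<close>, where \<open>x\<close> agrees with \<open>y\<close>.\<close>
      have "continuous (at t within ?I T) y"
        using is_solutionD(2)[OF y(1)] t y(2)
        by (auto simp: continuous_on_eq_continuous_within sol_interval_def)
      moreover have "at t within ?I T = at t within ?I Tmax"
        using b below T
        by (intro at_within_nhd[of _ "{..<b}"]) (auto simp: sol_interval_def intro: less_le_trans)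
      ultimately have "continuous (at t within ?I Tmax) y" by simp
      then show "continuous (at t within ?I Tmax) x"
      proof (rule continuous_transform_within)
        show "0 < b - t" using b by simp
        show "y u = x u" if "u \<in> ?I Tmax" "dist u t < b - t" for u
          using x_eq[OF y(1), of u] below[of u] that by (auto simp: sol_interval_def dist_real_def)
      qed (rule t)
    qed
  qed
  then show thesis using Tmax x_eq by (rule that)
qed

theorem theorem3p1:
  fixes \<alpha> \<tau>1 \<tau>2 \<gamma> r :: real and \<phi> g :: "real \<Rightarrow> real"
  assumes "0 < \<alpha>" and "\<alpha> \<le> 1"
    and "0 \<le> \<tau>1" and "0 \<le> \<tau>2"
    and "r = \<tau>1 + \<tau>2"
    and "continuous_on {- r..0} \<phi>"
    and "locally_lipschitz g"
  shows "\<exists>Tmax x.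
           is_solution \<alpha> \<tau>1 \<tau>2 \<gamma> g \<phi> Tmax x \<and>
           (\<forall>T y. is_solution \<alpha> \<tau>1 \<tau>2 \<gamma> g \<phi> T y \<longrightarrow>
              T \<le> Tmax \<and> (\<forall>t\<in>sol_interval r T. y t = x t)) \<and>
           (globally_lipschitz g \<longrightarrow> Tmax = \<infinity>)"
proof -
  have \<phi>: "continuous_on {- (\<tau>1 + \<tau>2)..0} \<phi>"
    using assms by simp
  obtain Tmax x where sol: "is_solution \<alpha> \<tau>1 \<tau>2 \<gamma> g \<phi> Tmax x"
    and max: "\<And>T y. is_solution \<alpha> \<tau>1 \<tau>2 \<gamma> g \<phi> T y \<Longrightarrow> T \<le> Tmax"
    and eq: "\<And>T y t. is_solution \<alpha> \<tau>1 \<tau>2 \<gamma> g \<phi> T y \<Longrightarrow> t \<in> sol_interval (\<tau>1 + \<tau>2) T \<Longrightarrow> y t = x t"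
    using maximal_solution_exists[OF assms(1,3,4) \<phi> assms(7)] by blast
  have "Tmax = \<infinity>" if lip: "globally_lipschitz g"
  proof -
    obtain y where "is_solution \<alpha> \<tau>1 \<tau>2 \<gamma> g \<phi> \<infinity> y"
      using global_solution_exists[OF assms(1,3,4) \<phi> lip] .
    from max[OF this] show ?thesis by simp
  qed
  with sol max eq show ?thesis
    unfolding \<open>r = \<tau>1 + \<tau>2\<close> by blast
qed

end
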